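(* Let $n\ge 1$ and let $k_1,\dots,k_I$ be positive integers with $k_1+\cdots+k_I=n$. Let $\mathcal D(k_1,\dots,k_I)$ be the set of all diagonalizable complex $n\times n$ matrices $A$ which have exactly $I$ distinct eigenvalues, with multiplicities $k_1,\dots,k_I$ (the values of the eigenvalues being otherwise unrestricted). Then the complex codimension of $\mathcal D(k_1,\dots,k_I)$ in the space $C^{nn}$ of all complex $n\times n$ matrices is $$\sum_{i=1}^I (k_i^2-1).$$
   Context: A matrix is diagonalizable if it equals $T\Lambda T^{-1}$ with $T$ invertible and $\Lambda$ diagonal. "Complex dimension" of a subset of $C^{nn}$ is the usual dimension over $\mathbb C$ (of a complex manifold, or of a constructible subset of affine space). The complex codimension of a subset of $C^{nn}$ is $n^2$ (the complex dimension of $C^{nn}$) minus the complex dimension of the subset. *)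

theory Defs
  imports "HOL-Analysis.Analysis" "HOL-Computational_Algebra.Polynomial"
begin

section \<open>Complex dimension of subsets of complex affine space\<close>

(* has_derivative is the real (Frechet) derivative; requiring it to be linear over the complex
   numbers makes this complex differentiability in several variables.
   Only used for open U. *)
definition holomorphic_map_on :: "(complex^'m \<Rightarrow> complex^'p) \<Rightarrow> (complex^'m) set \<Rightarrow> bool"
  where "holomorphic_map_on f U \<longleftrightarrow>
    (\<forall>x\<in>U. \<exists>D. (f has_derivative D) (at x) \<and> Vector_Spaces.linear (*s) (*s) D)"

(* Embedded complex submanifold of pure dimension d: around each point of M some biholomorphic
   change of coordinates f straightens M to a coordinate subspace of dimension d. *)
definition complex_submanifold :: "nat \<Rightarrow> (complex^'m) set \<Rightarrow> bool"
  where "complex_submanifold d M \<longleftrightarrow>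
    (\<forall>p\<in>M. \<exists>U V (f :: complex^'m \<Rightarrow> complex^'m) g J.
        open U \<and> p \<in> U \<and> open V \<and> homeomorphism U V f g \<and>
        holomorphic_map_on f U \<and> holomorphic_map_on g V \<and>
        card J = d \<and> f ` (M \<inter> U) = {y \<in> V. \<forall>j. j \<notin> J \<longrightarrow> y $ j = 0})"

(* The largest dimension of a nonempty complex submanifold contained in S. For a complex
   submanifold this is the dimension of the manifold (complex_dim_submanifold below); for a
   constructible set it is the usual dimension, since such a set is a finite union of nonsingular
   locally closed subvarieties and its dimension is the largest of theirs. The set under Sup is
   bounded by CARD('m); it is empty only for S = {}, where Sup gives 0. *)
definition complex_dim :: "(complex^'m) set \<Rightarrow> nat"
  where "complex_dim S = Sup {d. \<exists>M. M \<subseteq> S \<and> M \<noteq> {} \<and> complex_submanifold d M}"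

definition complex_codim :: "(complex^'m) set \<Rightarrow> int"
  where "complex_codim S = int CARD('m) - int (complex_dim S)"

lemma holomorphic_map_onD:
  assumes "holomorphic_map_on f U" "x \<in> U"
  obtains D where "(f has_derivative D) (at x)" "Vector_Spaces.linear (*s) (*s) D"
  using assms unfolding holomorphic_map_on_def by blast

lemma complex_submanifoldE:
  fixes M :: "(complex^'m) set"
  assumes "complex_submanifold d M" "p \<in> M"
  obtains U V :: "(complex^'m) set" and f g :: "complex^'m \<Rightarrow> complex^'m" and J
  where "open U" "p \<in> U" "open V" "homeomorphism U V f g"
    "holomorphic_map_on f U" "holomorphic_map_on g V" "card J = d"
    "f ` (M \<inter> U) = {y \<in> V. \<forall>j. j \<notin> J \<longrightarrow> y $ j = 0}"
  using assms(1)[unfolded complex_submanifold_def, rule_format, OF assms(2)]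
  by (elim exE conjE) (rule that; assumption)

lemma complex_submanifold_mono:
  fixes M S :: "(complex^'m) set"
  assumes M: "complex_submanifold d M" and S: "complex_submanifold e S"
    and "M \<subseteq> S" "M \<noteq> {}"
  shows "d \<le> e"
proof -
  obtain p where p: "p \<in> M" using \<open>M \<noteq> {}\<close> by blast
  obtain U V :: "(complex^'m) set" and f g J where 1:
    "open U" "p \<in> U" "open V" "homeomorphism U V f g"
    "holomorphic_map_on f U" "holomorphic_map_on g V" "card J = d"
    "f ` (M \<inter> U) = {y \<in> V. \<forall>j. j \<notin> J \<longrightarrow> y $ j = 0}"
    by (rule complex_submanifoldE[OF M p])
  have "p \<in> S" using p \<open>M \<subseteq> S\<close> by blast
  obtain U' V' :: "(complex^'m) set" and f' g' J' where 2:
    "open U'" "p \<in> U'" "open V'" "homeomorphism U' V' f' g'"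
    "holomorphic_map_on f' U'" "holomorphic_map_on g' V'" "card J' = e"
    "f' ` (S \<inter> U') = {y \<in> V'. \<forall>j. j \<notin> J' \<longrightarrow> y $ j = 0}"
    by (rule complex_submanifoldE[OF S \<open>p \<in> S\<close>])
  have gf: "g (f x) = x" if "x \<in> U" for x using 1(4) that by (auto simp: homeomorphism_def)
  have fg: "f (g y) = y" "g y \<in> U" if "y \<in> V" for y
    using 1(4) that by (auto simp: homeomorphism_def)
  have gf': "g' (f' x) = x" if "x \<in> U'" for x using 2(4) that by (auto simp: homeomorphism_def)
  have pV: "f p \<in> V" and pV': "f' p \<in> V'"
    using 1(2,4) 2(2,4) by (auto simp: homeomorphism_def)
  obtain A where A: "(f has_derivative A) (at p)" "Vector_Spaces.linear (*s) (*s) A"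
    using holomorphic_map_onD[OF 1(5,2)] .
  obtain B where B: "(g has_derivative B) (at (f p))" "Vector_Spaces.linear (*s) (*s) B"
    using holomorphic_map_onD[OF 1(6) pV] .
  obtain A' where A': "(f' has_derivative A') (at p)" "Vector_Spaces.linear (*s) (*s) A'"
    using holomorphic_map_onD[OF 2(5,2)] .
  obtain B' where B': "(g' has_derivative B') (at (f' p))" "Vector_Spaces.linear (*s) (*s) B'"
    using holomorphic_map_onD[OF 2(6) pV'] .
  have gp: "g (f p) = p" using gf 1(2) by blast
  have B'A': "B' (A' x) = x" for x
  proof -
    have "(g' \<circ> f' has_derivative B' \<circ> A') (at p)"
      using diff_chain_at[OF A'(1) B'(1)] .
    moreover have "(g' \<circ> f' has_derivative id) (at p)"
      by (rule has_derivative_transform_within_open[OF has_derivative_id 2(1,2)]) (simp add: gf')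
    ultimately have "B' \<circ> A' = id" by (rule has_derivative_unique)
    then show ?thesis by (metis comp_apply id_apply)
  qed
  have AB: "A (B x) = x" for x
  proof -
    have "(f \<circ> g has_derivative A \<circ> B) (at (f p))"
      using diff_chain_at[OF B(1)] A(1) gp by simp
    moreover have "(f \<circ> g has_derivative id) (at (f p))"
      by (rule has_derivative_transform_within_open[OF has_derivative_id 1(3) pV])
        (simp add: fg)
    ultimately have "A \<circ> B = id" by (rule has_derivative_unique)
    then show ?thesis by (metis comp_apply id_apply)
  qed
  define h where "h = f' \<circ> g"
  define H where "H = A' \<circ> B"
  have hH: "(h has_derivative H) (at (f p))"
    unfolding h_def H_def using diff_chain_at[OF B(1)] A'(1) gp by simp
  have linH: "Vector_Spaces.linear (*s) (*s) H"
    unfolding H_def by (rule Vector_Spaces.linear_compose[OF B(2) A'(2)])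
  have injH: "inj H"
    by (rule inj_on_inverseI[where g = "A \<circ> B'"]) (simp add: H_def B'A' AB)
  define L where "L = {x::complex^'m. \<forall>j. j \<notin> J \<longrightarrow> x $ j = 0}"
  define L' where "L' = {x::complex^'m. \<forall>j. j \<notin> J' \<longrightarrow> x $ j = 0}"
  have dims: "vec.dim L = d" "vec.dim L' = e"
    using 1(7) 2(7) by (simp_all add: L_def L'_def dim_substandard_cart)
  have "f p \<in> f ` (M \<inter> U)" using p 1(2) by blast
  then have fpL: "f p \<in> L" using 1(8) by (simp add: L_def)
  have "f' p \<in> f' ` (S \<inter> U')" using \<open>p \<in> S\<close> 2(2) by blast
  then have hfp: "h (f p) \<in> L'" using 2(8) gp by (simp add: L'_def h_def)
  have near: "\<forall>\<^sub>F y in at (f p). y \<in> L \<longrightarrow> h y \<in> L'"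
  proof -
    have "isCont g (f p)" using B(1) has_derivative_continuous by blast
    then have "\<forall>\<^sub>F y in at (f p). g y \<in> U'"
      using 2(1,2) gp by (metis isCont_def topological_tendstoD)
    moreover have "\<forall>\<^sub>F y in at (f p). y \<in> V"
      using 1(3) pV by (rule eventually_at_in_open')
    ultimately show ?thesis
    proof eventually_elim
      case (elim y)
      show ?case
      proof
        assume "y \<in> L"
        then have "y \<in> f ` (M \<inter> U)" using elim 1(8) by (simp add: L_def)
        then have "g y \<in> M" using gf by auto
        then have "f' (g y) \<in> f' ` (S \<inter> U')" using elim \<open>M \<subseteq> S\<close> by blast
        then show "h y \<in> L'" using 2(8) by (simp add: L'_def h_def)
      qed
    qed
  qed
  have "H v \<in> L'" if v: "v \<in> L" for v
  proof -
    have "H v $ j = 0" if j: "j \<notin> J'" for j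
    proof -
      define c where "c = (\<lambda>t::real. f p + t *\<^sub>R v)"
      have c: "(c has_derivative (\<lambda>t. t *\<^sub>R v)) (at 0)"
        unfolding c_def by (auto intro!: derivative_eq_intros)
      have c0: "c 0 = f p" by (simp add: c_def)
      have "(h \<circ> c has_derivative H \<circ> (\<lambda>t. t *\<^sub>R v)) (at 0)"
        using diff_chain_at[OF c] hH c0 by simp
      then have "((\<lambda>t. h (c t)) has_derivative (\<lambda>t. H (t *\<^sub>R v))) (at 0)"
        by (simp add: o_def)
      then have d1: "((\<lambda>t. h (c t) $ j) has_derivative (\<lambda>t. H (t *\<^sub>R v) $ j)) (at 0)"
        by (rule bounded_linear.has_derivative[OF bounded_linear_vec_nth, unfolded o_def])
      have "\<forall>\<^sub>F y in nhds (f p). y \<in> L \<longrightarrow> h y \<in> L'"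
        using near hfp by (auto simp: eventually_at_filter elim: eventually_mono)
      moreover have "(c \<longlongrightarrow> f p) (nhds 0)"
        using has_derivative_continuous[OF c] c0 tendsto_at_iff_tendsto_nhds[of c 0]
        by (simp add: isCont_def)
      ultimately have "\<forall>\<^sub>F t in nhds 0. c t \<in> L \<longrightarrow> h (c t) \<in> L'"
        by (rule eventually_compose_filterlim)
      moreover have "c t \<in> L" for t using fpL v by (simp add: c_def L_def)
      ultimately have "\<forall>\<^sub>F t in nhds 0. h (c t) $ j = 0"
        using j by (simp add: L'_def eventually_mono)
      then obtain W where W: "open W" "(0::real) \<in> W" "\<And>t. t \<in> W \<Longrightarrow> h (c t) $ j = 0"
        unfolding eventually_nhds by blast
      have "((\<lambda>t. h (c t) $ j) has_derivative (\<lambda>t. 0)) (at 0)"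
        by (rule has_derivative_transform_within_open[OF has_derivative_const W(1,2)])
          (simp add: W(3))
      from has_derivative_unique[OF d1 this] show ?thesis by (metis scaleR_one)
    qed
    then show ?thesis by (simp add: L'_def)
  qed
  then have sub: "H ` L \<subseteq> L'" by blast
  have "vec.dim (H ` L) = vec.dim L"
    by (rule vec.dim_image_eq[OF linH]) (use injH in \<open>auto simp: inj_on_def\<close>)
  then show "d \<le> e" using vec.dim_subset[OF sub] dims by simp
qed

proposition complex_dim_submanifold:
  assumes "complex_submanifold d M" "M \<noteq> {}"
  shows "complex_dim M = d"
  unfolding complex_dim_def
proof (rule cSup_eq_maximum)
  show "d \<in> {d. \<exists>N. N \<subseteq> M \<and> N \<noteq> {} \<and> complex_submanifold d N}"
    using assms by blast
next
  fix e assume "e \<in> {d. \<exists>N. N \<subseteq> M \<and> N \<noteq> {} \<and> complex_submanifold d N}"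
  then obtain N where "N \<subseteq> M" "N \<noteq> {}" "complex_submanifold e N" by blast
  then show "e \<le> d" using complex_submanifold_mono assms(1) by blast
qed

section \<open>Matrices with prescribed eigenvalue multiplicities\<close>

definition diagonalizable :: "complex^'n^'n \<Rightarrow> bool"
  where "diagonalizable A \<longleftrightarrow>
    (\<exists>T \<Lambda> :: complex^'n^'n. invertible T \<and> (\<forall>i j. i \<noteq> j \<longrightarrow> \<Lambda> $ i $ j = 0) \<and>
      A = T ** \<Lambda> ** matrix_inv T)"

definition eigenvalue :: "complex^'n^'n \<Rightarrow> complex \<Rightarrow> bool"
  where "eigenvalue A z \<longleftrightarrow> (\<exists>v. v \<noteq> 0 \<and> A *v v = z *s v)"

definition charpoly :: "complex^'n^'n \<Rightarrow> complex poly"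
  where "charpoly A = det (mat [:0, 1:] - map_matrix (\<lambda>a. [:a:]) A)"

definition multiplicity_set :: "nat \<Rightarrow> (nat \<Rightarrow> nat) \<Rightarrow> (complex^'n^'n) set"
  where "multiplicity_set m k =
    {A. diagonalizable A \<and>
        (\<exists>z. inj_on z {1..m} \<and> {w. eigenvalue A w} = z ` {1..m} \<and>
             (\<forall>i\<in>{1..m}. order (z i) (charpoly A) = k i))}"

(* identifies the space of square matrices with affine space, the entries being the coordinates *)
definition flatten :: "complex^'n^'n \<Rightarrow> complex^('n \<times> 'n)"
  where "flatten A = (\<chi> ij. A $ fst ij $ snd ij)"

end

theory Submission
  imports Defs
begin

text \<open>The set of matrices with multiplicities \<open>k\<^sub>1, \<dots>, k\<^sub>m\<close> is itself a complex submanifold. Near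
  \<open>A = T \<Lambda> T\<inverse>\<close> with \<open>\<Lambda>\<close> diagonal, every matrix has the form
  \<open>P B P\<inverse>\<close>, where \<open>P = T (1 + X)\<close>, \<open>X\<close> vanishes on the blocks of equal eigenvalues of \<open>\<Lambda>\<close>, and \<open>B\<close> is
  block diagonal: the derivative of \<open>(X, B) \<mapsto> P B P\<inverse>\<close> at \<open>(0, \<Lambda>)\<close> is
  \<open>(X, B) \<mapsto> T (B + X \<Lambda> - \<Lambda> X) T\<inverse>\<close>, which is injective because distinct blocks carry distinct
  eigenvalues. If \<open>B\<close> is close to \<open>\<Lambda>\<close> then each block contributes an eigenvalue and different blocks
  contribute different ones, so \<open>B\<close> is diagonalizable with \<open>m\<close> eigenvalues iff its blocks are scalar.
  These are linear conditions on \<open>B\<close>, which remove all but one of the \<open>k\<^sub>i\<^sup>2\<close> coordinates of the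
  \<open>i\<close>-th block.\<close>

section \<open>Calculus of complex matrices\<close>

lemma matrix_inv_mult:
  fixes A :: "complex^'n^'n"
  assumes "invertible A"
  shows "A ** matrix_inv A = mat 1" "matrix_inv A ** A = mat 1"
  using someI_ex[OF assms[unfolded invertible_def]] by (auto simp: matrix_inv_def)

lemma matrix_inv_unique:
  fixes A B :: "complex^'n^'n"
  assumes "A ** B = mat 1"
  shows "matrix_inv A = B"
  by (metis assms invertible_right_inverse matrix_inv_mult(2) matrix_mul_assoc matrix_mul_lid
      matrix_mul_rid)

text \<open>Real bilinearity suffices because the spaces are finite-dimensional. The interpretation
  supplies the product rule, continuity and the distributive laws for \<open>**\<close>.\<close>

interpretation matrix_mult: bounded_bilinear "(**) :: complex^'n^'n \<Rightarrow> _ \<Rightarrow> complex^'n^'n"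
proof (subst bilinear_conv_bounded_bilinear[symmetric], unfold bilinear_def, intro conjI allI)
  fix A :: "complex^'n^'n"
  show "linear ((**) A)"
    by (rule linearI) (vector matrix_matrix_mult_def sum.distrib algebra_simps scaleR_sum_right)+
  show "linear (\<lambda>x. x ** A)"
    by (rule linearI) (vector matrix_matrix_mult_def sum.distrib algebra_simps scaleR_sum_right)+
qed

lemma differentiable_vec:
  fixes f :: "'a::euclidean_space \<Rightarrow> 'b::euclidean_space^'n"
  assumes "\<And>i. (\<lambda>x. f x $ i) differentiable (at a)"
  shows "f differentiable (at a)"
  unfolding differentiable_componentwise_within[of f]
proof
  fix u :: "'b^'n" assume "u \<in> Basis"
  then obtain i b where u: "u = axis i b" by (auto simp: Basis_vec_def)
  have "(\<lambda>x. f x $ i \<bullet> b) differentiable (at a)"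
    by (rule differentiable_inner[OF assms differentiable_const])
  then show "(\<lambda>x. f x \<bullet> u) differentiable (at a)" by (simp add: u inner_axis)
qed

lemma differentiable_det:
  fixes F :: "'a::euclidean_space \<Rightarrow> complex^'n^'n"
  assumes "\<And>i j. (\<lambda>x. F x $ i $ j) differentiable (at a)"
  shows "(\<lambda>x. det (F x)) differentiable (at a)"
proof -
  obtain D where D: "((\<lambda>x. F x $ i $ j) has_derivative D i j) (at a)" for i j
    using assms unfolding differentiable_def by metis
  show ?thesis unfolding det_def differentiable_def
    by (rule exI, rule has_derivative_sum, rule has_derivative_mult[OF has_derivative_const],
        rule has_derivative_prod, rule D)
qed

lemma differentiable_matrix_nth:
  "(\<lambda>M :: complex^'n^'n. M $ i $ j) differentiable (at A)"
  unfolding differentiable_def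
  by (rule exI, rule bounded_linear_imp_has_derivative,
      rule bounded_linear_compose[OF bounded_linear_vec_nth bounded_linear_vec_nth])

text \<open>Column \<open>j\<close> of the inverse solves \<open>A *v x = axis j 1\<close>, so
  Cramer's rule gives its entries as quotients of determinants, which are visibly differentiable in
  \<open>A\<close>.\<close>

lemma matrix_inv_cramer:
  fixes A :: "complex^'n^'n"
  assumes "invertible A"
  shows "matrix_inv A $ i $ j = det (\<chi> p q. if q = i then axis j 1 $ p else A $ p $ q) / det A"
proof -
  have "A *v (matrix_inv A *v axis j 1) = axis j 1"
    by (simp add: matrix_vector_mul_assoc matrix_inv_mult assms)
  then have "matrix_inv A *v axis j 1 = (\<chi> i. det (\<chi> p q. if q = i then axis j 1 $ p else A $ p $ q) / det A)"
    using cramer assms invertible_det_nz by blast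
  moreover have "(matrix_inv A *v axis j 1) $ i = matrix_inv A $ i $ j"
    by (simp add: matrix_vector_mult_def axis_def if_distrib cong: if_cong)
  ultimately show ?thesis by simp
qed

lemma open_invertible: "open {A :: complex^'n^'n. invertible A}"
proof -
  have "continuous_on UNIV (det :: complex^'n^'n \<Rightarrow> complex)"
    by (rule continuous_at_imp_continuous_on)
      (auto intro!: differentiable_imp_continuous_within differentiable_det differentiable_matrix_nth)
  then have "open {A :: complex^'n^'n. det A \<noteq> 0}"
    by (intro open_Collect_neq continuous_intros)
  then show ?thesis by (simp add: invertible_det_nz)
qed

text \<open>Cramer's formula shows that some derivative \<open>D\<close> exists; differentiating the
  identity \<open>M ** matrix_inv M = mat 1\<close> then determines it.\<close>

lemma has_derivative_matrix_inv:
  fixes A :: "complex^'n^'n"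
  assumes "invertible A"
  shows "(matrix_inv has_derivative (\<lambda>H. - (matrix_inv A ** H ** matrix_inv A))) (at A)"
proof -
  define c where "c = (\<lambda>M :: complex^'n^'n. \<chi> i j. det (\<chi> p q. if q = i then axis j 1 $ p else M $ p $ q) / det M)"
  have "c differentiable (at A)"
  proof (intro differentiable_vec)
    fix i j
    have "(\<lambda>M :: complex^'n^'n. det (\<chi> p q. if q = i then axis j 1 $ p else M $ p $ q)) differentiable (at A)"
    proof (rule differentiable_det)
      fix p q
      show "(\<lambda>M :: complex^'n^'n. (\<chi> p q. if q = i then axis j 1 $ p else M $ p $ q) $ p $ q)
          differentiable (at A)"
        by (cases "q = i") (auto intro: differentiable_matrix_nth)
    qed
    then show "(\<lambda>x. c x $ i $ j) differentiable (at A)"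
      using assms by (auto simp: c_def invertible_det_nz intro!: differentiable_divide
        differentiable_det differentiable_matrix_nth)
  qed
  then obtain D where "(c has_derivative D) (at A)" by (auto simp: differentiable_def)
  then have D: "(matrix_inv has_derivative D) (at A)"
    by (rule has_derivative_transform_within_open[OF _ open_invertible])
      (use assms in \<open>simp_all add: c_def vec_eq_iff matrix_inv_cramer\<close>)
  have "((\<lambda>M. M ** matrix_inv M) has_derivative (\<lambda>H. A ** D H + H ** matrix_inv A)) (at A)"
    by (rule matrix_mult.FDERIV[OF has_derivative_ident D])
  moreover have "((\<lambda>M. M ** matrix_inv M) has_derivative (\<lambda>H. 0)) (at A)"
    by (rule has_derivative_transform_within_open[OF has_derivative_const open_invertible])
      (use assms in \<open>auto simp: matrix_inv_mult\<close>)
  ultimately have "A ** D H + H ** matrix_inv A = 0" for H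
    using has_derivative_unique by (metis (no_types, lifting))
  then have "A ** D H = - (H ** matrix_inv A)" for H by (simp add: eq_neg_iff_add_eq_0)
  then have "matrix_inv A ** (A ** D H) = - (matrix_inv A ** H ** matrix_inv A)" for H
    by (simp add: matrix_mult.minus_right matrix_mul_assoc)
  then have "D H = - (matrix_inv A ** H ** matrix_inv A)" for H
    by (simp add: matrix_mul_assoc matrix_inv_mult assms)
  then have "D = (\<lambda>H. - (matrix_inv A ** H ** matrix_inv A))" by blast
  then show ?thesis using D by simp
qed

lemma continuous_on_matrix_inv: "continuous_on {A :: complex^'n^'n. invertible A} matrix_inv"
  by (rule continuous_at_imp_continuous_on) (auto intro: has_derivative_continuous has_derivative_matrix_inv)

section \<open>Diagonalizable matrices and their eigenvalue multiplicities\<close>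

definition diag :: "('n \<Rightarrow> complex) \<Rightarrow> complex^'n^'n"
  where "diag d = (\<chi> a c. if a = c then d a else 0)"

lemma if_zero_mult: "(if P then x else 0) * y = (if P then x * y else 0)" for x y :: complex
  by simp

lemma diag_nth: "diag d $ a $ c = (if a = c then d a else 0)"
  by (simp add: diag_def)

lemma diag_mult_nth: "(diag d ** B) $ a $ c = d a * B $ a $ c"
  by (simp add: matrix_matrix_mult_def diag_def if_zero_mult)

lemma mult_diag_nth: "(B ** diag d) $ a $ c = B $ a $ c * d c"
  by (simp add: matrix_matrix_mult_def diag_def if_distrib cong: if_cong)

lemma diag_mult_vec_nth: "(diag d *v v) $ a = d a * v $ a"
  by (simp add: matrix_vector_mult_def diag_def if_zero_mult)

section \<open>Characteristic polynomial and spectrum of a conjugated diagonal matrix\<close>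

lemma sum_const_poly: "(\<Sum>x\<in>S. [:f x:]) = [:sum f S:]"
  by (induction S rule: infinite_finite_induct) simp_all

lemma map_matrix_pCons_mult:
  fixes A B :: "complex^'n^'n"
  shows "map_matrix (\<lambda>a. [:a:]) (A ** B) = map_matrix (\<lambda>a. [:a:]) A ** map_matrix (\<lambda>a. [:a:]) B"
  by (simp add: vec_eq_iff matrix_matrix_mult_def sum_const_poly mult.commute)

text \<open>Embedding entries as constant polynomials is multiplicative and the scalar matrix
  \<open>?X\<close> is central, so the usual argument works over the polynomial ring:
  \<open>?X\<close> minus the conjugate is the conjugate of \<open>?X - ?C A\<close>.\<close>

lemma charpoly_conj:
  fixes A T :: "complex^'n^'n"
  assumes "invertible T"
  shows "charpoly (T ** A ** matrix_inv T) = charpoly A"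
proof -
  let ?C = "map_matrix (\<lambda>a :: complex. [:a:]) :: complex^'n^'n \<Rightarrow> complex poly^'n^'n"
  let ?X = "mat [:0, 1:] :: complex poly^'n^'n"
  have comm: "M ** ?X = ?X ** M" for M :: "complex poly^'n^'n"
    by (simp add: vec_eq_iff matrix_matrix_mult_def mat_def if_distrib if_distribR cong: if_cong)
  have sub: "M ** (P - Q) = M ** P - M ** Q" "(P - Q) ** M = P ** M - Q ** M"
    for M P Q :: "complex poly^'n^'n"
    by (vector matrix_matrix_mult_def sum_subtractf[symmetric] algebra_simps)+
  have one: "?C T ** ?C (matrix_inv T) = mat 1"
    unfolding map_matrix_pCons_mult[symmetric] matrix_inv_mult[OF assms]
    by (simp add: vec_eq_iff mat_def)
  have "?C T ** (?X - ?C A) ** ?C (matrix_inv T)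
      = ?X ** (?C T ** ?C (matrix_inv T)) - ?C (T ** A ** matrix_inv T)"
    by (simp only: sub comm map_matrix_pCons_mult matrix_mul_assoc)
  then have "?X - ?C (T ** A ** matrix_inv T) = ?C T ** (?X - ?C A) ** ?C (matrix_inv T)"
    by (simp add: one)
  then have "charpoly (T ** A ** matrix_inv T) = det (?C T) * charpoly A * det (?C (matrix_inv T))"
    by (simp add: charpoly_def det_mul)
  also have "\<dots> = det (?C T ** ?C (matrix_inv T)) * charpoly A"
    by (simp add: det_mul)
  finally show ?thesis by (simp add: one)
qed

lemma charpoly_diag: "charpoly (diag d :: complex^'n^'n) = (\<Prod>a\<in>UNIV. [:- d a, 1:])"
  by (simp add: charpoly_def det_diagonal diag_nth mat_def)

lemma order_linear_factor: "order z [:- c, 1:] = (if c = z then 1 else 0)" for z c :: complex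
  using order_power_n_n[of z 1] by (auto intro: order_0I)

lemma order_prod_linear:
  fixes d :: "'a \<Rightarrow> complex"
  assumes "finite S"
  shows "order z (\<Prod>a\<in>S. [:- d a, 1:]) = card {a\<in>S. d a = z}"
  using assms
proof (induction S)
  case (insert x S)
  have "(\<Prod>a\<in>S. [:- d a, 1:]) \<noteq> 0" using insert.hyps by simp
  then have "[:- d x, 1:] * (\<Prod>a\<in>S. [:- d a, 1:]) \<noteq> 0" by (simp del: mult_pCons_left)
  from order_mult[OF this, of z]
  have "order z (\<Prod>a\<in>insert x S. [:- d a, 1:])
      = (if d x = z then 1 else 0) + card {a\<in>S. d a = z}"
    using insert by (simp add: order_linear_factor del: mult_pCons_left)
  moreover have "{a\<in>insert x S. d a = z} = (if d x = z then insert x {a\<in>S. d a = z} else {a\<in>S. d a = z})"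
    by auto
  ultimately show ?case using insert.hyps by simp
qed simp

lemma order_charpoly_conj_diag:
  fixes T :: "complex^'n^'n"
  assumes "invertible T"
  shows "order z (charpoly (T ** diag d ** matrix_inv T)) = card {a. d a = z}"
  by (simp add: charpoly_conj assms charpoly_diag order_prod_linear)

text \<open>\<open>matrix_inv T\<close> turns an eigenvector into one of \<open>diag d\<close>, and
  any nonzero coordinate \<open>u $ a\<close> of it forces the eigenvalue to be \<open>d a\<close>.
  Conversely \<open>T *v axis a 1\<close> is an eigenvector for \<open>d a\<close>.\<close>

lemma eigenvalue_conj_diag:
  fixes T :: "complex^'n^'n"
  assumes T: "invertible T"
  shows "{w. eigenvalue (T ** diag d ** matrix_inv T) w} = range d"
proof (intro set_eqI iffI)
  fix w assume "w \<in> {w. eigenvalue (T ** diag d ** matrix_inv T) w}"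
  then obtain v where v: "v \<noteq> 0" "T ** diag d ** matrix_inv T *v v = w *s v"
    by (auto simp: eigenvalue_def)
  define u where "u = matrix_inv T *v v"
  have vu: "v = T *v u" by (simp add: u_def matrix_vector_mul_assoc matrix_inv_mult T)
  have "matrix_inv T *v (T ** diag d ** matrix_inv T *v v) = matrix_inv T *v (w *s v)"
    using v by simp
  then have "diag d *v u = w *s u"
    by (simp add: matrix_vector_mul_assoc matrix_mul_assoc matrix_inv_mult T u_def
        vector_scalar_commute)
  moreover obtain a where "u $ a \<noteq> 0" using v(1) vu by (metis matrix_vector_mult_0_right vec_eq_iff zero_index)
  ultimately have "d a * u $ a = w * u $ a" by (metis diag_mult_vec_nth vector_smult_component)
  with \<open>u $ a \<noteq> 0\<close> show "w \<in> range d" by auto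
next
  fix w assume "w \<in> range d"
  then obtain a where a: "w = d a" by blast
  let ?v = "T *v axis a 1"
  have "diag d *v axis a 1 = w *s axis a 1"
    by (simp add: vec_eq_iff diag_mult_vec_nth a axis_def)
  moreover have "T ** diag d ** matrix_inv T *v ?v = T *v (diag d *v axis a 1)"
    by (metis T matrix_inv_mult(2) matrix_mul_assoc matrix_mul_rid matrix_vector_mul_assoc)
  ultimately have "T ** diag d ** matrix_inv T *v ?v = w *s ?v"
    by (simp add: vector_scalar_commute)
  moreover have "?v \<noteq> 0"
  proof
    assume "?v = 0"
    then have "matrix_inv T *v ?v = 0" by simp
    then have "(axis a 1 :: complex^'n) = 0"
      by (simp add: matrix_vector_mul_assoc matrix_inv_mult T)
    then show False by (simp add: axis_eq_0_iff)
  qed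
  ultimately show "w \<in> {w. eigenvalue (T ** diag d ** matrix_inv T) w}"
    by (auto simp: eigenvalue_def)
qed

section \<open>Multiplicities as sizes of the fibres of the diagonal\<close>

definition level_pattern :: "nat \<Rightarrow> (nat \<Rightarrow> nat) \<Rightarrow> ('n \<Rightarrow> 'b) \<Rightarrow> bool"
  where "level_pattern m k l \<longleftrightarrow>
    (\<exists>z. inj_on z {1..m} \<and> range l = z ` {1..m} \<and> (\<forall>i\<in>{1..m}. card {a. l a = z i} = k i))"

text \<open>Eigenvalues and their orders in the characteristic polynomial are read off the diagonal,
  so only the fibres of \<open>l\<close> matter.\<close>

lemma mem_multiplicity_set_iff:
  fixes A :: "complex^'n^'n"
  shows "A \<in> multiplicity_set m k \<longleftrightarrow>
    (\<exists>(T :: complex^'n^'n) l. invertible T \<and> A = T ** diag l ** matrix_inv T \<and> level_pattern m k l)"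
proof
  assume A: "A \<in> multiplicity_set m k"
  then obtain T L :: "complex^'n^'n" where T: "invertible T" "\<forall>i j. i \<noteq> j \<longrightarrow> L $ i $ j = 0"
    "A = T ** L ** matrix_inv T"
    unfolding multiplicity_set_def diagonalizable_def by blast
  define l where "l = (\<lambda>a. L $ a $ a)"
  have "L = diag l" using T(2) by (auto simp: vec_eq_iff diag_nth l_def)
  then have "A = T ** diag l ** matrix_inv T" using T(3) by simp
  moreover from this have "level_pattern m k l"
    using A T(1) by (simp add: multiplicity_set_def level_pattern_def eigenvalue_conj_diag
      order_charpoly_conj_diag)
  ultimately show "\<exists>(T :: complex^'n^'n) l. invertible T \<and> A = T ** diag l ** matrix_inv T \<and> level_pattern m k l"
    using T(1) by (intro exI conjI)
next
  assume "\<exists>(T :: complex^'n^'n) l. invertible T \<and> A = T ** diag l ** matrix_inv T \<and> level_pattern m k l"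
  then obtain T :: "complex^'n^'n" and l where *: "invertible T" "A = T ** diag l ** matrix_inv T" "level_pattern m k l"
    by blast
  have "diagonalizable A"
    unfolding diagonalizable_def by (intro exI[of _ T] exI[of _ "diag l"]) (simp add: * diag_nth)
  with * show "A \<in> multiplicity_set m k"
    by (simp add: multiplicity_set_def level_pattern_def eigenvalue_conj_diag
      order_charpoly_conj_diag)
qed

text \<open>The pattern depends on the partition of the indices into fibres, not on the labels,
  which may even change type. A representative \<open>r i\<close> of each fibre transports the
  enumeration \<open>z\<close> to the new labels.\<close>

lemma level_pattern_cong:
  assumes l: "level_pattern m k l" and ker: "\<And>a c. l a = l c \<longleftrightarrow> \<mu> a = \<mu> c"
  shows "level_pattern m k \<mu>"
proof -
  obtain z where z: "inj_on z {1..m}" "range l = z ` {1..m}"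
    "\<And>i. i \<in> {1..m} \<Longrightarrow> card {a. l a = z i} = k i"
    using l unfolding level_pattern_def by blast
  have "\<exists>r. l r = z i" if "i \<in> {1..m}" for i using z(2) that by (metis imageI imageE)
  then obtain r where r: "\<And>i. i \<in> {1..m} \<Longrightarrow> l (r i) = z i" by metis
  have eq: "\<mu> a = \<mu> (r i) \<longleftrightarrow> l a = z i" if "i \<in> {1..m}" for a i
    using ker r that by metis
  have "inj_on (\<lambda>i. \<mu> (r i)) {1..m}"
    using z(1) r eq unfolding inj_on_def by metis
  moreover have "range \<mu> = (\<lambda>i. \<mu> (r i)) ` {1..m}"
  proof (intro set_eqI iffI)
    fix w assume "w \<in> range \<mu>"
    then obtain a where "w = \<mu> a" by blast
    moreover obtain i where "i \<in> {1..m}" "l a = z i" using z(2) by blast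
    ultimately show "w \<in> (\<lambda>i. \<mu> (r i)) ` {1..m}" using eq by blast
  qed auto
  moreover have "card {a. \<mu> a = \<mu> (r i)} = k i" if "i \<in> {1..m}" for i
    using z(3) eq that by simp
  ultimately show ?thesis unfolding level_pattern_def by blast
qed

lemma level_pattern_card_range: "level_pattern m k l \<Longrightarrow> card (range l) = m"
  unfolding level_pattern_def by (metis card_atLeastAtMost card_image diff_Suc_1)

text \<open>Gershgorin's estimate, applied to the part of an eigenvector in one block, places the
  eigenvalue near the value of \<open>l\<close> on that block; so each eigenvector lives in a single block.\<close>

lemma block_diagonal_scalar:
  fixes Y T :: "complex^'n^'n" and l e :: "'n \<Rightarrow> complex"
  assumes gap: "\<And>a c. l a \<noteq> l c \<Longrightarrow> 2 * \<delta> \<le> cmod (l a - l c)"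
    and block: "\<And>a c. l a \<noteq> l c \<Longrightarrow> Y $ a $ c = 0"
    and near: "\<And>a. (\<Sum>c\<in>UNIV. cmod (Y $ a $ c - diag l $ a $ c)) < \<delta>"
    and T: "invertible T" and Y: "Y = T ** diag e ** matrix_inv T"
    and card: "card (range e) \<le> card (range l)"
  obtains \<nu> where "Y = diag (\<nu> \<circ> l)"
proof -
  have YT: "Y ** T = T ** diag e"
    by (metis T Y matrix_inv_mult(2) matrix_mul_assoc matrix_mul_rid)
  have close: "cmod (e c - l a) < \<delta>" if a: "T $ a $ c \<noteq> 0" for a c
  proof -
    let ?B = "{a'. l a' = l a}"
    \<comment> \<open>\<open>a0\<close> is a row of the block where column \<open>c\<close> of
      \<open>T\<close> is largest in modulus. Entries of \<open>Y\<close> outside the block vanish,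
      so this maximum dominates every term of row \<open>a0\<close> in the eigenvector
      equation.\<close>
    have "Max ((\<lambda>a'. cmod (T $ a' $ c)) ` ?B) \<in> (\<lambda>a'. cmod (T $ a' $ c)) ` ?B"
      by (rule Max_in) auto
    then obtain a0 where a0: "l a0 = l a" "cmod (T $ a0 $ c) = Max ((\<lambda>a'. cmod (T $ a' $ c)) ` ?B)"
      by auto
    have max: "cmod (T $ q $ c) \<le> cmod (T $ a0 $ c)" if "l q = l a" for q
      unfolding a0(2) by (rule Max_ge) (use that in auto)
    have pos: "cmod (T $ a0 $ c) > 0" using max[OF refl] zero_less_norm_iff[of "T $ a $ c"] a by linarith
    have "(\<Sum>q\<in>UNIV. Y $ a0 $ q * T $ q $ c) = T $ a0 $ c * e c"
      using arg_cong[OF YT, of "\<lambda>M. M $ a0 $ c"] by (simp add: mult_diag_nth) (simp add: matrix_matrix_mult_def)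
    moreover have "(\<Sum>q\<in>UNIV. diag l $ a0 $ q * T $ q $ c) = l a0 * T $ a0 $ c"
      by (simp add: diag_nth if_zero_mult)
    ultimately have "(e c - l a) * T $ a0 $ c = (\<Sum>q\<in>UNIV. (Y $ a0 $ q - diag l $ a0 $ q) * T $ q $ c)"
      by (simp add: left_diff_distrib sum_subtractf a0(1) mult.commute[of "T $ a0 $ c"])
    then have "cmod (e c - l a) * cmod (T $ a0 $ c) = cmod (\<Sum>q\<in>UNIV. (Y $ a0 $ q - diag l $ a0 $ q) * T $ q $ c)"
      by (metis norm_mult)
    also have "\<dots> \<le> (\<Sum>q\<in>UNIV. cmod (Y $ a0 $ q - diag l $ a0 $ q) * cmod (T $ a0 $ c))"
    proof (rule sum_norm_le)
      fix q
      show "cmod ((Y $ a0 $ q - diag l $ a0 $ q) * T $ q $ c)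
          \<le> cmod (Y $ a0 $ q - diag l $ a0 $ q) * cmod (T $ a0 $ c)"
      proof (cases "l q = l a")
        case True
        then show ?thesis by (simp add: norm_mult mult_left_mono max)
      next
        case False
        then have "Y $ a0 $ q = 0" "diag l $ a0 $ q = 0" using block a0(1) by (auto simp: diag_nth)
        then show ?thesis by simp
      qed
    qed
    also have "\<dots> < \<delta> * cmod (T $ a0 $ c)"
      using near[of a0] pos by (simp add: sum_distrib_right[symmetric])
    finally show ?thesis using pos by simp
  qed
  have "\<exists>c. T $ a $ c \<noteq> 0" for a
  proof (rule ccontr)
    assume "\<nexists>c. T $ a $ c \<noteq> 0"
    then have "(T ** matrix_inv T) $ a $ a = 0" by (simp add: matrix_matrix_mult_def)
    then show False by (simp add: matrix_inv_mult T mat_def)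
  qed
  then obtain col where col: "\<And>a. T $ a $ col a \<noteq> 0" by metis
  \<comment> \<open>An invertible matrix has no zero row, so every block meets some eigenvector; its
    eigenvalue is the candidate for the scalar of that block.\<close>
  define \<nu> where "\<nu> w = e (col (inv l w))" for w
  have \<nu>: "cmod (\<nu> w - w) < \<delta>" if "w \<in> range l" for w
    using close[OF col, of "inv l w"] that by (simp add: \<nu>_def f_inv_into_f)
  \<comment> \<open>The discs of radius \<open>\<delta>\<close> around the values of
    \<open>l\<close> are disjoint, since the gap is at least \<open>2 * \<delta>\<close>.\<close>
  have sep: "w = w'" if "w \<in> range l" "w' \<in> range l" "cmod (x - w) < \<delta>" "cmod (x - w') < \<delta>" for w w' x
  proof (rule ccontr)
    assume "w \<noteq> w'"
    then have "2 * \<delta> \<le> cmod (w - w')" using gap that(1,2) by auto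
    moreover have "cmod (w - w') \<le> cmod (x - w) + cmod (x - w')"
      by (metis norm_minus_commute norm_diff_triangle_le order_refl)
    ultimately show False using that by linarith
  qed
  have "inj_on \<nu> (range l)"
    by (rule inj_onI) (metis \<nu> sep)
  moreover have "\<nu> ` range l \<subseteq> range e" by (auto simp: \<nu>_def)
  \<comment> \<open>Different blocks already use up different eigenvalues, and by
    \<open>card\<close> there are no further ones. Hence each block has a single eigenvalue.\<close>
  ultimately have "\<nu> ` range l = range e"
    using card by (intro card_seteq) (auto simp: card_image)
  then have e: "e c = \<nu> (l a)" if "T $ a $ c \<noteq> 0" for a c
  proof -
    obtain w where w: "w \<in> range l" "e c = \<nu> w"
      using \<open>\<nu> ` range l = range e\<close> by (metis imageE rangeI)
    have "w = l a" by (rule sep[of w "l a" "e c"]) (use w \<nu>[OF w(1)] close[OF that] in auto)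
    then show ?thesis using w by simp
  qed
  have "diag (\<nu> \<circ> l) ** T = Y ** T"
    unfolding YT vec_eq_iff diag_mult_nth mult_diag_nth using e by (metis comp_apply mult.commute mult_zero_left)
  then have "diag (\<nu> \<circ> l) = Y"
    by (metis T matrix_inv_mult(1) matrix_mul_assoc matrix_mul_rid)
  then show ?thesis using that by metis
qed

section \<open>Flattening, complex scaling and invariance under conjugation\<close>

lemma flatten_inject: "flatten A = flatten B \<longleftrightarrow> A = B"
  by (auto simp: flatten_def vec_eq_iff)

lemma flatten_add: "flatten (A + B) = flatten A + flatten B"
  by (simp add: flatten_def vec_eq_iff)

text \<open>Complex scaling of a matrix is written as a product with \<open>mat z\<close>, because
  \<open>*s\<close> on \<open>complex^'n^'n\<close> would take its scalars from
  \<open>complex^'n\<close>.\<close>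

lemma mat_mult_nth:
  fixes A :: "complex^'n^'n"
  shows "(mat z ** A) $ a $ c = z * A $ a $ c" "(A ** mat z) $ a $ c = A $ a $ c * z"
proof -
  have "mat z = (diag (\<lambda>_. z) :: complex^'n^'n)" by (simp add: mat_def diag_def)
  then show "(mat z ** A) $ a $ c = z * A $ a $ c" "(A ** mat z) $ a $ c = A $ a $ c * z"
    by (simp_all add: diag_mult_nth mult_diag_nth)
qed

lemma mat_mult_commute: "A ** mat z = mat z ** A" for A :: "complex^'n^'n"
  by (simp add: vec_eq_iff mat_mult_nth)

lemma flatten_mat_mult: "flatten (mat z ** A) = z *s flatten A"
  by (simp add: flatten_def vec_eq_iff mat_mult_nth)

lemma mat_mult_left_commute: "A ** (mat z ** B) = mat z ** (A ** B)" for A B :: "complex^'n^'n"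
  by (simp add: matrix_mul_assoc mat_mult_commute)

lemma bounded_linear_flatten: "bounded_linear (flatten :: complex^'n^'n \<Rightarrow> _)"
  unfolding linear_conv_bounded_linear[symmetric]
  by (rule linearI) (simp_all add: flatten_def vec_eq_iff)

lemma matrix_inv_prod:
  fixes S T :: "complex^'n^'n"
  assumes "invertible S" "invertible T"
  shows "matrix_inv (S ** T) = matrix_inv T ** matrix_inv S"
proof (rule matrix_inv_unique)
  have "S ** T ** (matrix_inv T ** matrix_inv S) = S ** (T ** matrix_inv T) ** matrix_inv S"
    by (simp only: matrix_mul_assoc)
  then show "S ** T ** (matrix_inv T ** matrix_inv S) = mat 1"
    by (simp add: matrix_inv_mult assms)
qed

lemma invertible_matrix_inv: "invertible (A :: complex^'n^'n) \<Longrightarrow> invertible (matrix_inv A)"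
  by (metis invertible_def matrix_inv_mult)

lemma matrix_inv_matrix_inv: "invertible A \<Longrightarrow> matrix_inv (matrix_inv A) = (A :: complex^'n^'n)"
  by (simp add: matrix_inv_mult matrix_inv_unique)

lemma multiplicity_set_conj:
  fixes S E :: "complex^'n^'n"
  assumes "invertible S" "E \<in> multiplicity_set m k"
  shows "S ** E ** matrix_inv S \<in> multiplicity_set m k"
proof -
  obtain T :: "complex^'n^'n" and l where *: "invertible T" "E = T ** diag l ** matrix_inv T"
    "level_pattern m k l"
    using assms(2) mem_multiplicity_set_iff by blast
  then have "S ** E ** matrix_inv S = (S ** T) ** diag l ** matrix_inv (S ** T)"
    by (simp add: matrix_inv_prod assms(1) matrix_mul_assoc)
  with * assms(1) show ?thesis
    unfolding mem_multiplicity_set_iff by (blast intro: invertible_mult)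
qed

text \<open>Conjugation by \<open>matrix_inv S\<close> undoes conjugation by \<open>S\<close>.
  Membership of \<open>P B P\<inverse>\<close> is thereby reduced to that of the block diagonal
  factor \<open>B\<close>.\<close>

lemma multiplicity_set_conj_iff:
  fixes S E :: "complex^'n^'n"
  assumes "invertible S"
  shows "S ** E ** matrix_inv S \<in> multiplicity_set m k \<longleftrightarrow> E \<in> multiplicity_set m k"
proof
  assume "S ** E ** matrix_inv S \<in> multiplicity_set m k"
  from multiplicity_set_conj[OF invertible_matrix_inv[OF assms] this]
  have "matrix_inv S ** S ** E ** (matrix_inv S ** S) \<in> multiplicity_set m k"
    by (simp add: matrix_inv_matrix_inv assms matrix_mul_assoc)
  then show "E \<in> multiplicity_set m k" by (simp add: matrix_inv_mult assms)
qed (rule multiplicity_set_conj[OF assms])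

lemma clinearI:
  fixes f :: "complex^'a \<Rightarrow> complex^'b"
  assumes "\<And>x y. f (x + y) = f x + f y" "\<And>z x. f (z *s x) = z *s f x"
  shows "Vector_Spaces.linear (*s) (*s) f"
  using assms by unfold_locales (auto simp: vec.scale_right_distrib vec.scale_left_distrib)

lemma clinear_inv:
  fixes f :: "complex^'a \<Rightarrow> complex^'b"
  assumes "Vector_Spaces.linear (*s) (*s) f" "bij f"
  shows "Vector_Spaces.linear (*s) (*s) (inv f)"
proof (rule clinearI)
  interpret f: Vector_Spaces.linear "(*s)" "(*s)" f by fact
  note fi = bij_is_surj[OF assms(2), THEN surj_f_inv_f] bij_is_inj[OF assms(2), THEN inv_f_f]
  show "inv f (x + y) = inv f x + inv f y" for x y
    by (metis f.add fi)
  show "inv f (z *s x) = z *s inv f x" for z x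
    by (metis f.scale fi)
qed

section \<open>Block coordinates on the space of matrices\<close>

definition off_blocks :: "('n \<Rightarrow> 'b) \<Rightarrow> complex^('n \<times> 'n) \<Rightarrow> complex^'n^'n"
  where "off_blocks l Z = (\<chi> a c. if l a = l c then 0 else Z $ (a, c))"

text \<open>The representative \<open>inv l (l a)\<close> of the block of \<open>a\<close> carries the scalar of the block and the
  other diagonal coordinates are measured from it, so that the block diagonal matrices with scalar
  blocks form a coordinate subspace.\<close>

definition blocks :: "('n \<Rightarrow> 'b) \<Rightarrow> complex^('n \<times> 'n) \<Rightarrow> complex^'n^'n"
  where "blocks l Z = (\<chi> a c. if l a \<noteq> l c then 0 else if a \<noteq> c \<or> inv l (l a) = a then Z $ (a, c)
    else Z $ (a, c) + Z $ (inv l (l a), inv l (l a)))"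

text \<open>Each coordinate of \<open>Z\<close> feeds either \<open>off_blocks\<close> or
  \<open>blocks\<close>, according to whether its two indices lie in different blocks. The free ones
  are all of the first kind, together with one scalar for each block.\<close>

definition free_coords :: "('n \<Rightarrow> 'b) \<Rightarrow> ('n \<times> 'n) set"
  where "free_coords l = {(a, c). l a \<noteq> l c} \<union> {(a, c). a = c \<and> inv l (l a) = a}"

lemma off_blocks_add: "off_blocks l (Z + W) = off_blocks l Z + off_blocks l W"
  by (simp add: off_blocks_def vec_eq_iff)

lemma blocks_add: "blocks l (Z + W) = blocks l Z + blocks l W"
  by (simp add: blocks_def vec_eq_iff)

lemma off_blocks_smult: "off_blocks l (z *s Z) = mat z ** off_blocks l Z"
  by (simp add: off_blocks_def vec_eq_iff mat_mult_nth)

lemma blocks_smult: "blocks l (z *s Z) = mat z ** blocks l Z"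
  by (simp add: blocks_def vec_eq_iff mat_mult_nth algebra_simps)

lemma bounded_linear_off_blocks: "bounded_linear (off_blocks l :: complex^('n \<times> 'n) \<Rightarrow> complex^'n^'n)"
  unfolding linear_conv_bounded_linear[symmetric]
  by (rule linearI) (simp_all add: off_blocks_def vec_eq_iff)

lemma bounded_linear_blocks: "bounded_linear (blocks l :: complex^('n \<times> 'n) \<Rightarrow> complex^'n^'n)"
  unfolding linear_conv_bounded_linear[symmetric]
  by (rule linearI) (simp_all add: blocks_def vec_eq_iff algebra_simps)

lemma inv_level: "l (inv l (l a)) = l a"
  by (simp add: f_inv_into_f)

text \<open>The entry at the representative is itself a coordinate; once it is known to vanish, no
  diagonal entry is shifted any more.\<close>

lemma blocks_eq_0D:
  assumes "blocks l Z = 0" "l a = l c"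
  shows "Z $ (a, c) = 0"
proof -
  have *: "blocks l Z $ p $ q = 0" for p q using assms(1) by simp
  have "Z $ (inv l (l a), inv l (l a)) = 0"
    using *[of "inv l (l a)" "inv l (l a)"] by (simp add: blocks_def inv_level)
  then show ?thesis using *[of a c] assms(2) by (auto simp: blocks_def split: if_splits)
qed

text \<open>The coordinates outside \<open>free_coords\<close> are the off-diagonal entries within a
  block and the deviations of its diagonal entries from the representative one; they all vanish iff
  the block is scalar.\<close>

lemma blocks_eq_diag_iff:
  "(\<exists>\<nu>. blocks l Z = diag (\<nu> \<circ> l)) \<longleftrightarrow> (\<forall>j. j \<notin> free_coords l \<longrightarrow> Z $ j = 0)"
proof
  assume "\<exists>\<nu>. blocks l Z = diag (\<nu> \<circ> l)"
  then obtain \<nu> where "blocks l Z = diag (\<nu> \<circ> l)" by blast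
  then have *: "blocks l Z $ a $ c = diag (\<nu> \<circ> l) $ a $ c" for a c by simp
  show "\<forall>j. j \<notin> free_coords l \<longrightarrow> Z $ j = 0"
  proof (intro allI impI)
    fix j assume "j \<notin> free_coords l"
    then obtain a c where j: "j = (a, c)" "l a = l c" "a \<noteq> c \<or> inv l (l a) \<noteq> a"
      by (cases j) (auto simp: free_coords_def)
    show "Z $ j = 0"
      using *[of a c] *[of "inv l (l a)" "inv l (l a)"] j
      by (auto simp: blocks_def diag_nth inv_level split: if_splits)
  qed
next
  assume *: "\<forall>j. j \<notin> free_coords l \<longrightarrow> Z $ j = 0"
  have "blocks l Z = diag ((\<lambda>w. Z $ (inv l w, inv l w)) \<circ> l)"
    unfolding vec_eq_iff
  proof (intro allI)
    fix a c
    show "blocks l Z $ a $ c = diag ((\<lambda>w. Z $ (inv l w, inv l w)) \<circ> l) $ a $ c"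
      using *[rule_format, of "(a, c)"] by (auto simp: blocks_def diag_nth free_coords_def)
  qed
  then show "\<exists>\<nu>. blocks l Z = diag (\<nu> \<circ> l)" by blast
qed

text \<open>The pairs within a common block number \<Sum> \<open>k i * k i\<close>. Their complement
  is free, and the \<open>m\<close> representatives account for the \<open>- 1\<close> in each
  summand, which lies under the sum.\<close>

lemma card_free_coords:
  fixes l :: "'n::finite \<Rightarrow> 'b"
  assumes "level_pattern m k l"
  shows "int (card (free_coords l)) = int CARD('n \<times> 'n) - (\<Sum>i=1..m. (int (k i))\<^sup>2 - 1)"
proof -
  obtain z where z: "inj_on z {1..m}" "range l = z ` {1..m}"
    "\<And>i. i \<in> {1..m} \<Longrightarrow> card {a. l a = z i} = k i"
    using assms unfolding level_pattern_def by blast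
  let ?E = "{(a, c). l a = l c}" and ?R = "{(a, c). a = c \<and> inv l (l a) = a}"
  have "?E = (\<Union>i\<in>{1..m}. {a. l a = z i} \<times> {a. l a = z i})"
  proof (intro set_eqI iffI)
    fix p assume "p \<in> ?E"
    then obtain a c where p: "p = (a, c)" "l a = l c" by blast
    moreover obtain i where "i \<in> {1..m}" "l a = z i" using z(2) by blast
    ultimately show "p \<in> (\<Union>i\<in>{1..m}. {a. l a = z i} \<times> {a. l a = z i})" by (intro UN_I[of i]) auto
  qed auto
  moreover have "card (\<Union>i\<in>{1..m}. {a. l a = z i} \<times> {a. l a = z i})
      = (\<Sum>i\<in>{1..m}. card ({a. l a = z i} \<times> {a. l a = z i}))"
  proof (intro card_UN_disjoint ballI impI)
    fix i j assume "i \<in> {1..m}" "j \<in> {1..m}" "i \<noteq> j"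
    then have "z i \<noteq> z j" using z(1) by (simp only: inj_on_eq_iff not_False_eq_True)
    then show "({a. l a = z i} \<times> {a. l a = z i}) \<inter> ({a. l a = z j} \<times> {a. l a = z j}) = {}"
      by auto
  qed simp_all
  ultimately have E: "card ?E = (\<Sum>i\<in>{1..m}. k i * k i)"
    using z(3) by (simp add: card_cartesian_product)
  have "?R = (\<lambda>w. (inv l w, inv l w)) ` range l"
  proof (intro equalityI subsetI)
    fix p assume "p \<in> ?R"
    then obtain a where "p = (a, a)" "inv l (l a) = a" by auto
    then have "p = (inv l (l a), inv l (l a))" by simp
    then show "p \<in> (\<lambda>w. (inv l w, inv l w)) ` range l" by (rule image_eqI) simp
  qed (auto simp: inv_level)
  moreover have "inj_on (\<lambda>w. (inv l w, inv l w)) (range l)"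
    by (auto intro!: inj_onI dest: inv_into_injective)
  ultimately have R: "card ?R = m"
    using level_pattern_card_range[OF assms] by (simp add: card_image)
  have "card (free_coords l) = card (- ?E) + card ?R"
    unfolding free_coords_def
    by (subst card_Un_disjoint[symmetric]) (auto intro!: arg_cong[where f = card])
  moreover have "int (card (- ?E)) = int CARD('n \<times> 'n) - int (card ?E)"
    by (simp add: Compl_eq_Diff_UNIV card_Diff_subset of_nat_diff card_mono del: card_prod)
  ultimately show ?thesis
    by (simp add: E R sum_subtractf power2_eq_square del: card_prod)
qed

text \<open>The indices are put in bijection with the disjoint union of the sets
  \<open>{..<k i}\<close>, whose first projection has fibres of the right sizes; positivity of
  \<open>k\<close> makes every label occur.\<close>

lemma level_pattern_exists:
  assumes pos: "\<And>i. i \<in> {1..m} \<Longrightarrow> k i > 0" and sum: "(\<Sum>i=1..m. k i) = CARD('n::finite)"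
  obtains l :: "'n::finite \<Rightarrow> nat" where "level_pattern m k l"
proof -
  let ?S = "Sigma {1..m} (\<lambda>i. {..<k i})"
  have "card ?S = CARD('n)" using sum by (subst card_SigmaI) auto
  then obtain h :: "'n \<Rightarrow> nat \<times> nat" where h: "bij_betw h UNIV ?S"
    using finite_same_card_bij[of "UNIV :: 'n set" ?S] by auto
  have im: "range h = ?S" using h by (simp add: bij_betw_def)
  have "range (fst \<circ> h) = {1..m}"
    unfolding image_comp[symmetric] im using pos by force
  moreover have "card {a. (fst \<circ> h) a = i} = k i" if "i \<in> {1..m}" for i
  proof -
    have "h ` {a. (fst \<circ> h) a = i} = {i} \<times> {..<k i}"
    proof (intro equalityI subsetI)
      fix p assume "p \<in> h ` {a. (fst \<circ> h) a = i}"
      then have "p \<in> ?S" "fst p = i" using im by auto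
      then show "p \<in> {i} \<times> {..<k i}" by auto
    next
      fix p assume "p \<in> {i} \<times> {..<k i}"
      then have "p \<in> ?S" "fst p = i" using that by auto
      moreover from this obtain a where "p = h a" using im by (metis rangeE)
      ultimately show "p \<in> h ` {a. (fst \<circ> h) a = i}" by auto
    qed
    moreover have "inj_on h {a. (fst \<circ> h) a = i}"
      using h by (auto simp: bij_betw_def intro: inj_on_subset)
    ultimately show ?thesis by (metis card_cartesian_product_singleton card_image card_lessThan)
  qed
  ultimately have "level_pattern m k (fst \<circ> h)"
    unfolding level_pattern_def by (intro exI[of _ id]) auto
  then show ?thesis using that by blast
qed

section \<open>Charts around diagonalizable matrices\<close>

definition frame :: "complex^'n^'n \<Rightarrow> ('n \<Rightarrow> 'b) \<Rightarrow> complex^('n \<times> 'n) \<Rightarrow> complex^'n^'n"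
  where "frame T l Z = T ** (mat 1 + off_blocks l Z)"

text \<open>This sends coordinates to matrices; the straightening map demanded by
  \<open>complex_submanifold\<close> is its local inverse.\<close>

definition chart :: "complex^'n^'n \<Rightarrow> ('n \<Rightarrow> 'b) \<Rightarrow> complex^('n \<times> 'n) \<Rightarrow> complex^('n \<times> 'n)"
  where "chart T l Z = flatten (frame T l Z ** blocks l Z ** matrix_inv (frame T l Z))"

text \<open>The product rule for \<open>P B Q\<close> with \<open>Q\<close> the inverse of
  \<open>P\<close>: here \<open>R\<close> is the derivative of \<open>P\<close>, and that of
  \<open>Q\<close> is \<open>- (Q ** R ** Q)\<close>. It is needed at all points near the centre, as
  the inverse function theorem asks for a continuous derivative.\<close>

definition chart_deriv ::
    "complex^'n^'n \<Rightarrow> ('n \<Rightarrow> 'b) \<Rightarrow> complex^('n \<times> 'n) \<Rightarrow> complex^('n \<times> 'n) \<Rightarrow> complex^('n \<times> 'n)"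
  where "chart_deriv T l Z H =
    (let P = frame T l Z; Q = matrix_inv P; R = T ** off_blocks l H in
      flatten (P ** blocks l Z ** - (Q ** R ** Q) + (P ** blocks l H + R ** blocks l Z) ** Q))"

lemma has_derivative_frame: "(frame T l has_derivative (\<lambda>H. T ** off_blocks l H)) (at Z)"
proof -
  have "((\<lambda>Z. mat 1 + off_blocks l Z) has_derivative (\<lambda>H. 0 + off_blocks l H)) (at Z)"
    by (intro has_derivative_add has_derivative_const bounded_linear_imp_has_derivative
        bounded_linear_off_blocks)
  from matrix_mult.FDERIV[OF has_derivative_const[of T] this]
  show ?thesis by (simp add: frame_def[abs_def] matrix_mult.zero_left)
qed

lemma continuous_on_frame: "continuous_on S (frame T l)"
  using has_derivative_continuous[OF has_derivative_frame]
  by (intro continuous_at_imp_continuous_on) blast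

lemma has_derivative_chart:
  fixes T :: "complex^'n^'n"
  assumes "invertible (frame T l Z)"
  shows "(chart T l has_derivative chart_deriv T l Z) (at Z)"
proof -
  have "((\<lambda>Z. frame T l Z ** blocks l Z) has_derivative
      (\<lambda>H. frame T l Z ** blocks l H + T ** off_blocks l H ** blocks l Z)) (at Z)"
    by (intro matrix_mult.FDERIV has_derivative_frame bounded_linear_imp_has_derivative
        bounded_linear_blocks)
  moreover have "((\<lambda>Z. matrix_inv (frame T l Z)) has_derivative
      (\<lambda>H. - (matrix_inv (frame T l Z) ** (T ** off_blocks l H) ** matrix_inv (frame T l Z)))) (at Z)"
    by (rule has_derivative_compose[OF has_derivative_frame has_derivative_matrix_inv[OF assms]])
  ultimately show ?thesis
    unfolding chart_def[abs_def] chart_deriv_def[abs_def] Let_def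
    by (rule bounded_linear.has_derivative[OF bounded_linear_flatten matrix_mult.FDERIV])
qed

text \<open>Every summand contains the direction exactly once. Complex linearity is what turns real
  differentiability of the chart into holomorphy.\<close>

lemma clinear_chart_deriv: "Vector_Spaces.linear (*s) (*s) (chart_deriv T l Z)"
proof (rule clinearI)
  fix H K
  show "chart_deriv T l Z (H + K) = chart_deriv T l Z H + chart_deriv T l Z K"
    by (simp add: chart_deriv_def Let_def off_blocks_add blocks_add matrix_mult.add_left
      matrix_mult.add_right matrix_mult.minus_right flatten_add[symmetric])
      (simp add: algebra_simps)
next
  fix z H
  have add: "mat z ** A + mat z ** B = mat z ** (A + B)" for A B :: "complex^'a^'a"
    by (simp add: matrix_mult.add_right)
  have left: "mat z ** A ** B = mat z ** (A ** B)" for A B :: "complex^'a^'a"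
    by (simp add: matrix_mul_assoc)
  have minus: "- (mat z ** A) = mat z ** - A" for A :: "complex^'a^'a"
    by (simp add: matrix_mult.minus_right)
  show "chart_deriv T l Z (z *s H) = z *s chart_deriv T l Z H"
    by (simp only: chart_deriv_def Let_def off_blocks_smult blocks_smult mat_mult_left_commute
      left minus add flatten_mat_mult)
qed

lemma scaleR_eq_smult: "r *\<^sub>R x = complex_of_real r *s x"
  by (simp add: vec_eq_iff) (simp add: scaleR_conv_of_real)

lemma bounded_linear_clinear:
  fixes f :: "complex^'a \<Rightarrow> complex^'b"
  assumes "Vector_Spaces.linear (*s) (*s) f"
  shows "bounded_linear f"
proof -
  interpret f: Vector_Spaces.linear "(*s)" "(*s)" f by fact
  show ?thesis
    unfolding linear_conv_bounded_linear[symmetric]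
    by (intro linearI) (simp_all add: f.add f.scale scaleR_eq_smult)
qed

text \<open>In finite dimension, continuity in \<open>Z\<close> for each fixed direction
  \<open>H\<close> gives continuity of the derivative as an operator.\<close>

lemma continuous_on_chart_deriv:
  assumes "\<And>Z. Z \<in> U \<Longrightarrow> invertible (frame T l Z)"
  shows "continuous_on U (\<lambda>Z. chart_deriv T l Z H)"
proof -
  have "continuous_on U (\<lambda>Z. matrix_inv (frame T l Z))"
    by (rule continuous_on_compose2[OF continuous_on_matrix_inv continuous_on_frame]) (use assms in auto)
  then show ?thesis
    unfolding chart_deriv_def Let_def
    by (intro bounded_linear.continuous_on[OF bounded_linear_flatten] continuous_on_add
      continuous_on_minus matrix_mult.continuous_on continuous_on_frame continuous_on_const
      bounded_linear.continuous_on[OF bounded_linear_blocks] continuous_on_id)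
qed

text \<open>Undoing the conjugation by \<open>T\<close> leaves an equation whose entry at
  \<open>(a, c)\<close> is \<open>eq'\<close>. Within a block its second term vanishes, across
  blocks its first, and there \<open>l c - l a\<close> is nonzero.\<close>

lemma chart_deriv_inj:
  fixes T :: "complex^'n^'n" and l :: "'n \<Rightarrow> complex"
  assumes T: "invertible T" and Z: "off_blocks l Z = 0" "blocks l Z = diag l"
  shows "inj (chart_deriv T l Z)"
proof -
  interpret L: Vector_Spaces.linear "(*s)" "(*s)" "chart_deriv T l Z" by (rule clinear_chart_deriv)
  have "H = 0" if H: "chart_deriv T l Z H = 0" for H
  proof -
    have P: "frame T l Z = T" by (simp add: frame_def Z)
    let ?R = "off_blocks l H" and ?B = "blocks l H" and ?Q = "matrix_inv T"
    have "flatten (T ** diag l ** - (?Q ** (T ** ?R) ** ?Q) + (T ** ?B + T ** ?R ** diag l) ** ?Q) = 0"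
      using H by (simp add: chart_deriv_def P Z Let_def)
    then have "T ** diag l ** - (?Q ** (T ** ?R) ** ?Q) + (T ** ?B + T ** ?R ** diag l) ** ?Q = 0"
      (is "?X = 0") by (simp add: flatten_def vec_eq_iff)
    have can: "A ** ?Q ** T = A" "A ** T ** ?Q = A" for A :: "complex^'n^'n"
      by (simp_all add: matrix_mul_assoc[symmetric] matrix_inv_mult T)
    have "?Q ** ?X ** T = - (diag l ** ?R) + ?B + ?R ** diag l"
      by (simp add: matrix_mult.add_left matrix_mult.add_right matrix_mult.diff_left
        matrix_mult.diff_right matrix_mult.minus_left matrix_mult.minus_right matrix_mul_assoc can
        matrix_inv_mult T)
    moreover have "?Q ** ?X ** T = 0"
      by (simp only: \<open>?X = 0\<close>) (simp add: vec_eq_iff matrix_matrix_mult_def)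
    ultimately have eq: "- (diag l ** ?R) + ?B + ?R ** diag l = 0" by simp
    have eq': "?B $ a $ c + ?R $ a $ c * (l c - l a) = 0" for a c
      using arg_cong[OF eq, of "\<lambda>M. M $ a $ c"]
      by (simp add: diag_mult_nth mult_diag_nth algebra_simps)
    have "?B = 0"
    proof -
      have "?B $ a $ c = 0" for a c
        using eq'[of a c] by (cases "l a = l c") (auto simp: blocks_def)
      then show ?thesis by (simp add: vec_eq_iff)
    qed
    have "H $ (a, c) = 0" for a c
    proof (cases "l a = l c")
      case True
      then show ?thesis using blocks_eq_0D \<open>?B = 0\<close> by blast
    next
      case False
      then show ?thesis using eq'[of a c] \<open>?B = 0\<close> by (simp add: off_blocks_def)
    qed
    then show "H = 0" by (simp add: vec_eq_iff)
  qed
  then show ?thesis by (intro injI) (metis L.diff right_minus_eq)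
qed

text \<open>Assumption \<open>d\<close> says that the number of free coordinates is the same for
  every admissible diagonal, so the dimension is constant along the set.\<close>

lemma complex_submanifold_multiplicity_set:
  fixes m k
  defines "D \<equiv> multiplicity_set m k :: (complex^'n^'n) set"
  assumes d: "\<And>l :: 'n \<Rightarrow> complex. level_pattern m k l \<Longrightarrow> card (free_coords l) = d"
  shows "complex_submanifold d (flatten ` D)"
  unfolding complex_submanifold_def
proof
  fix p assume "p \<in> flatten ` D"
  then obtain A where A: "A \<in> D" "p = flatten A" by blast
  then obtain T :: "complex^'n^'n" and l where T: "invertible T" and AT: "A = T ** diag l ** matrix_inv T"
    and l: "level_pattern m k l"
    unfolding D_def mem_multiplicity_set_iff by blast
  obtain \<delta> where "\<delta> > 0" and gap: "\<And>a c. l a \<noteq> l c \<Longrightarrow> 2 * \<delta> \<le> cmod (l a - l c)"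
  proof -
    \<comment> \<open>Half the smallest distance between distinct eigenvalues serves as
      \<open>\<delta>\<close>; the inserted \<open>1\<close> keeps the minimum meaningful when there
      is only one eigenvalue.\<close>
    let ?S = "insert 1 ((\<lambda>(a, c). cmod (l a - l c)) ` {(a, c). l a \<noteq> l c})"
    have fin: "finite ?S" by simp
    have "Min ?S \<in> ?S" by (rule Min_in) auto
    then have "Min ?S > 0" by auto
    moreover have "Min ?S \<le> cmod (l a - l c)" if "l a \<noteq> l c" for a c
      by (rule Min_le[OF fin]) (use that in auto)
    ultimately show ?thesis by (intro that[of "Min ?S / 2"]) simp_all
  qed
  define near where "near Z \<longleftrightarrow> (\<forall>a. (\<Sum>c\<in>UNIV. cmod (blocks l Z $ a $ c - diag l $ a $ c)) < \<delta>)"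
    for Z
  define U where "U = {Z. invertible (frame T l Z)} \<inter> {Z. near Z}"
  have "open {Z. invertible (frame T l Z)}"
    using open_vimage[OF open_invertible continuous_on_frame] by (simp add: vimage_def)
  moreover have "open {Z. near Z}"
  proof -
    have nth: "continuous_on UNIV (\<lambda>Z. blocks l Z $ a $ c)" for a c
      by (intro bounded_linear.continuous_on[OF bounded_linear_vec_nth]
        bounded_linear.continuous_on[OF bounded_linear_blocks] continuous_on_id)
    have "{Z. near Z} = (\<Inter>a. {Z. (\<Sum>c\<in>UNIV. cmod (blocks l Z $ a $ c - diag l $ a $ c)) < \<delta>})"
      by (auto simp: near_def)
    moreover have "open {Z. (\<Sum>c\<in>UNIV. cmod (blocks l Z $ a $ c - diag l $ a $ c)) < \<delta>}" for a
      by (intro open_Collect_less continuous_intros nth)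
    ultimately show ?thesis by (simp add: open_INT)
  qed
  ultimately have "open U" unfolding U_def by (rule open_Int)
  have inv: "invertible (frame T l Z)" if "Z \<in> U" for Z using that by (simp add: U_def)
  \<comment> \<open>The coordinates of \<open>A\<close> itself: no conjugation beyond
    \<open>T\<close>, and the eigenvalue of each block placed at its representative.\<close>
  define Z0 where "Z0 = (\<chi> j. if fst j = snd j \<and> inv l (l (fst j)) = fst j then l (fst j) else 0)"
  have Z0: "off_blocks l Z0 = 0" "blocks l Z0 = diag l"
    by (auto simp: off_blocks_def blocks_def Z0_def vec_eq_iff diag_nth inv_level)
  have "Z0 \<in> U"
    using T \<open>\<delta> > 0\<close> by (simp add: U_def near_def frame_def Z0)
  have p: "chart T l Z0 = p"
    by (simp add: chart_def frame_def Z0 A AT)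
  \<comment> \<open>The inverse function theorem takes a left inverse of the derivative at the
    centre, which injectivity provides.\<close>
  obtain h where h: "linear h" "h \<circ> chart_deriv T l Z0 = id"
    using linear_injective_left_inverse[OF _ chart_deriv_inj[OF T Z0]]
      bounded_linear.linear[OF bounded_linear_clinear[OF clinear_chart_deriv]] by blast
  have h': "bounded_linear h" using h(1) by (simp add: linear_conv_bounded_linear)
  define G' where "G' Z = Blinfun (chart_deriv T l Z)" for Z
  have G': "blinfun_apply (G' Z) = chart_deriv T l Z" for Z
    by (simp add: G'_def bounded_linear_Blinfun_apply bounded_linear_clinear clinear_chart_deriv)
  obtain U' V g g' where IFT: "open U'" "U' \<subseteq> U" "Z0 \<in> U'" "open V" "chart T l Z0 \<in> V"
    "homeomorphism U' V (chart T l) g" "\<And>y. y \<in> V \<Longrightarrow> (g has_derivative (g' y)) (at y)"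
    "\<And>y. y \<in> V \<Longrightarrow> g' y = inv (blinfun_apply (G' (g y)))"
    "\<And>y. y \<in> V \<Longrightarrow> bij (blinfun_apply (G' (g y)))"
  proof (rule inverse_function_theorem[OF \<open>open U\<close> _ _ \<open>Z0 \<in> U\<close>])
    show "(chart T l has_derivative blinfun_apply (G' Z)) (at Z)" if "Z \<in> U" for Z
      unfolding G' using has_derivative_chart inv that by blast
    show "continuous_on U G'"
      by (rule continuous_on_blinfun_componentwise)
        (simp add: G' continuous_on_chart_deriv inv)
    show "Blinfun h o\<^sub>L G' Z0 = id_blinfun"
      using h(2) by (intro blinfun_eqI) (simp add: G' bounded_linear_Blinfun_apply h' fun_eq_iff)
  qed (use that in blast)
  have coords: "chart T l Z \<in> flatten ` D \<longleftrightarrow> (\<forall>j. j \<notin> free_coords l \<longrightarrow> Z $ j = 0)" if "Z \<in> U'" for Z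
  proof -
    have "Z \<in> U" using that IFT(2) by blast
    then have near: "(\<Sum>c\<in>UNIV. cmod (blocks l Z $ a $ c - diag l $ a $ c)) < \<delta>" for a
      by (simp add: U_def near_def)
    have "chart T l Z \<in> flatten ` D \<longleftrightarrow> blocks l Z \<in> D"
      using multiplicity_set_conj_iff[OF inv[OF \<open>Z \<in> U\<close>]]
      by (auto simp: chart_def D_def image_iff flatten_inject)
    also have "\<dots> \<longleftrightarrow> (\<exists>\<nu>. blocks l Z = diag (\<nu> \<circ> l))"
    proof
      assume "blocks l Z \<in> D"
      then obtain S :: "complex^'n^'n" and e where S: "invertible S"
        "blocks l Z = S ** diag e ** matrix_inv S" and e: "level_pattern m k e"
        unfolding D_def mem_multiplicity_set_iff by blast
      have "card (range e) \<le> card (range l)"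
        by (simp add: level_pattern_card_range[OF l] level_pattern_card_range[OF e])
      moreover have "blocks l Z $ a $ c = 0" if "l a \<noteq> l c" for a c
        using that by (simp add: blocks_def)
      ultimately obtain \<nu> where "blocks l Z = diag (\<nu> \<circ> l)"
        using block_diagonal_scalar[OF gap _ near S] by blast
      then show "\<exists>\<nu>. blocks l Z = diag (\<nu> \<circ> l)" by blast
    next
      assume "\<exists>\<nu>. blocks l Z = diag (\<nu> \<circ> l)"
      then obtain \<nu> where \<nu>: "blocks l Z = diag (\<nu> \<circ> l)" by blast
      have close: "cmod (\<nu> (l a) - l a) < \<delta>" for a
      proof -
        have "cmod (blocks l Z $ a $ a - diag l $ a $ a) < \<delta>"
          by (rule le_less_trans[OF member_le_sum near[of a]]) auto
        then show ?thesis by (simp add: \<nu> diag_nth)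
      qed
      \<comment> \<open>Scalars of different blocks stay apart because each moves by less than
        \<open>\<delta>\<close>; so the diagonal keeps its fibres.\<close>
      have "l a = l c \<longleftrightarrow> (\<nu> \<circ> l) a = (\<nu> \<circ> l) c" for a c
      proof
        assume "(\<nu> \<circ> l) a = (\<nu> \<circ> l) c"
        then have "cmod (l a - l c) \<le> cmod (\<nu> (l a) - l a) + cmod (\<nu> (l c) - l c)"
          by (metis comp_apply norm_minus_commute norm_diff_triangle_le order_refl)
        then show "l a = l c" using gap[of a c] close[of a] close[of c] by fastforce
      qed simp
      from level_pattern_cong[OF l this] have "level_pattern m k (\<nu> \<circ> l)" .
      moreover have "invertible (mat 1 :: complex^'n^'n)" "matrix_inv (mat 1) = (mat 1 :: complex^'n^'n)"
        by (auto simp: invertible_def intro: matrix_inv_unique)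
      ultimately show "blocks l Z \<in> D"
        unfolding D_def mem_multiplicity_set_iff \<nu>
        by (intro exI[of _ "mat 1"] exI[of _ "\<nu> \<circ> l"]) simp
    qed
    finally show ?thesis using blocks_eq_diag_iff by metis
  qed
  have gc: "g (chart T l Z) = Z" "chart T l Z \<in> V" if "Z \<in> U'" for Z
    using IFT(6) that by (auto simp: homeomorphism_def)
  have cg: "chart T l (g y) = y" "g y \<in> U'" if "y \<in> V" for y
    using IFT(6) that by (auto simp: homeomorphism_def)
  have img: "g ` (flatten ` D \<inter> V) = {y \<in> U'. \<forall>j. j \<notin> free_coords l \<longrightarrow> y $ j = 0}"
  proof (intro equalityI subsetI)
    fix Z assume "Z \<in> g ` (flatten ` D \<inter> V)"
    then obtain y where "y \<in> flatten ` D" "y \<in> V" "Z = g y" by blast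
    then have "Z \<in> U'" "chart T l Z \<in> flatten ` D" by (simp_all only: cg)
    then show "Z \<in> {y \<in> U'. \<forall>j. j \<notin> free_coords l \<longrightarrow> y $ j = 0}" by (simp add: coords)
  next
    fix Z assume "Z \<in> {y \<in> U'. \<forall>j. j \<notin> free_coords l \<longrightarrow> y $ j = 0}"
    then have "Z \<in> U'" "chart T l Z \<in> flatten ` D" by (simp_all add: coords)
    then show "Z \<in> g ` (flatten ` D \<inter> V)"
      by (intro image_eqI[of _ _ "chart T l Z"] IntI) (simp_all only: gc)
  qed
  have "holomorphic_map_on g V"
    unfolding holomorphic_map_on_def
  proof
    fix y assume y: "y \<in> V"
    \<comment> \<open>The inverse of a bijective complex-linear map is complex-linear, so the local
      inverse is holomorphic too.\<close>
    have "(g has_derivative inv (chart_deriv T l (g y))) (at y)"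
      using IFT(7,8)[OF y] by (simp add: G')
    moreover have "bij (chart_deriv T l (g y))" using IFT(9)[OF y] by (simp add: G')
    ultimately show "\<exists>D. (g has_derivative D) (at y) \<and> Vector_Spaces.linear (*s) (*s) D"
      using clinear_inv[OF clinear_chart_deriv] by blast
  qed
  moreover have "holomorphic_map_on (chart T l) U'"
    unfolding holomorphic_map_on_def
    using has_derivative_chart clinear_chart_deriv inv IFT(2) by blast
  ultimately show "\<exists>U V (f :: complex^('n \<times> 'n) \<Rightarrow> complex^('n \<times> 'n)) g J.
      open U \<and> p \<in> U \<and> open V \<and> homeomorphism U V f g \<and>
      holomorphic_map_on f U \<and> holomorphic_map_on g V \<and> card J = d \<and>
      f ` (flatten ` D \<inter> U) = {y \<in> V. \<forall>j. j \<notin> J \<longrightarrow> y $ j = 0}"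
    \<comment> \<open>The roles are exchanged: \<open>g\<close> straightens the set, from the
      neighbourhood \<open>V\<close> of \<open>p\<close> onto the coordinate domain
      \<open>U'\<close>.\<close>
    using IFT(1,4,5) homeomorphism_symD[OF IFT(6)] img d[OF l]
    unfolding p by - (rule exI[of _ V], rule exI[of _ U'], rule exI[of _ g],
      rule exI[of _ "chart T l"], rule exI[of _ "free_coords l"], intro conjI)
qed

section \<open>Codimension from the count of free coordinates\<close>

theorem corollary1p2:
  fixes m :: nat and k :: "nat \<Rightarrow> nat"
  assumes "\<And>i. i \<in> {1..m} \<Longrightarrow> k i > 0"
    and "(\<Sum>i=1..m. k i) = CARD('n::finite)"
  shows "complex_codim (flatten ` (multiplicity_set m k :: (complex^'n^'n) set))
           = (\<Sum>i=1..m. (int (k i))\<^sup>2 - 1)"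
proof -
  let ?D = "multiplicity_set m k :: (complex^'n^'n) set"
  obtain b :: "'n \<Rightarrow> nat" where "level_pattern m k b"
    using level_pattern_exists[OF assms] by blast
  \<comment> \<open>\<open>of_nat\<close> is injective on labels, so natural number labels become
    eigenvalues with the same fibres. The resulting diagonal matrix shows that the set is nonempty,
    which the dimension of a submanifold requires.\<close>
  then have l: "level_pattern m k (\<lambda>a. complex_of_nat (b a))"
    by (rule level_pattern_cong) simp
  have "invertible (mat 1 :: complex^'n^'n)" by (auto simp: invertible_def)
  with l have "?D \<noteq> {}" using mem_multiplicity_set_iff by blast
  define d where "d = card (free_coords (\<lambda>a. complex_of_nat (b a)))"
  have d: "int d = int CARD('n \<times> 'n) - (\<Sum>i=1..m. (int (k i))\<^sup>2 - 1)"
    unfolding d_def by (rule card_free_coords[OF l])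
  have "card (free_coords l) = d" if "level_pattern m k l" for l :: "'n \<Rightarrow> complex"
    using card_free_coords[OF that] d by linarith
  then have "complex_submanifold d (flatten ` ?D)"
    by (rule complex_submanifold_multiplicity_set)
  then have "complex_dim (flatten ` ?D) = d"
    by (rule complex_dim_submanifold) (use \<open>?D \<noteq> {}\<close> in simp)
  then show ?thesis using d by (simp add: complex_codim_def del: card_prod)
qed

end
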